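(* (i) Let $n\ge 1$ be an integer, let $m$ be an integer with $\gcd(n,m)=1$, and let $q=e^{2\pi m i/n}$. If $3\mid n$, then $$\sum_{k=0}^{n-1}q^{k}C_k^q=\frac12\left(i\sqrt{3}\left(\frac{m}{3}\right)-1\right).$$ (ii) Moreover, for any prime $p$ and any integer $a>0$, $$\sum_{k=0}^{p^a-1}C_k\equiv\frac12\left(3\left(\frac{p^a}{3}\right)-1\right)\pmod p.$$
   Context: The Gaussian $q$-binomial coefficient $\binom{n}{k}_q$ is the polynomial in $q$ given by $\binom{n}{k}_q=\dfrac{(q;q)_n}{(q;q)_k(q;q)_{n-k}}$ if $0\le k\le n$ and $\binom{n}{k}_q=0$ otherwise, where $(z;q)_n=\prod_{j=0}^{n-1}(1-zq^j)$. The $q$-Catalan number is the polynomial $C_n^q=\dfrac{1}{[n+1]_q}\binom{2n}{n}_q=\binom{2n}{n}_q-q\binom{2n}{n+1}_q$, where $[n+1]_q=\dfrac{1-q^{n+1}}{1-q}$; at a root of unity it denotes the value of this polynomial. $C_n=\frac{1}{n+1}\binom{2n}{n}$ is the ordinary Catalan number. $\left(\frac{\cdot}{3}\right)$ is the Legendre symbol modulo $3$ (equal to $0,1,-1$ for arguments $\equiv 0,1,2\pmod 3$). The congruence modulo $p$ is between rational numbers with denominator prime to $p$ (the right-hand side is an integer when $p\ne 3$, and equals $-1/2$ when $p=3$). *)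

theory Defs
  imports Complex_Main "HOL-Computational_Algebra.Computational_Algebra"
    "HOL-Number_Theory.Number_Theory"
begin

definition qpochhammer :: "'a::comm_ring_1 \<Rightarrow> 'a \<Rightarrow> nat \<Rightarrow> 'a" where
  "qpochhammer z q n = (\<Prod>j<n. 1 - z * q ^ j)"

text \<open>The indeterminate $q$ of the polynomials below.\<close>

abbreviation qX :: "'a::comm_ring_1 poly" where
  "qX \<equiv> [:0, 1:]"

text \<open>
  In the next three definitions \<open>div\<close> is Euclidean division of polynomials; every one of these
  divisions is exact, see \<open>qbinomial_exact\<close>, \<open>qnumber_exact\<close> and \<open>qcatalan_exact\<close>.
\<close>

definition qbinomial :: "nat \<Rightarrow> nat \<Rightarrow> 'a::field poly" where
  "qbinomial n k =
     (if k \<le> n then qpochhammer qX qX n div (qpochhammer qX qX k * qpochhammer qX qX (n - k))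
      else 0)"

definition qnumber :: "nat \<Rightarrow> 'a::field poly" where
  "qnumber n = (1 - qX ^ n) div (1 - qX)"

definition qcatalan :: "nat \<Rightarrow> 'a::field poly" where
  "qcatalan n = qbinomial (2 * n) n div qnumber (n + 1)"

lemma qpochhammer_Suc: "qpochhammer z q (Suc n) = qpochhammer z q n * (1 - z * q ^ n)"
  by (simp add: qpochhammer_def)

lemma one_minus_qX_power_neq: "(1 - qX ^ Suc n :: 'a::field poly) \<noteq> 0"
proof
  assume "(1 - qX ^ Suc n :: 'a poly) = 0"
  then have "poly (1 - qX ^ Suc n :: 'a poly) 0 = poly 0 0" by (rule arg_cong)
  then show False by (simp add: poly_power)
qed

lemma qpochhammer_qX_neq: "qpochhammer (qX :: 'a::field poly) qX n \<noteq> 0"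
  unfolding qpochhammer_def power_Suc[symmetric] prod_zero_iff[OF finite_lessThan]
  using one_minus_qX_power_neq[where ?'a = 'a] by blast

lemma qpochhammer_dvd:
  fixes x :: "'a::comm_ring_1"
  shows "k \<le> n \<Longrightarrow> qpochhammer x x k * qpochhammer x x (n - k) dvd qpochhammer x x n"
proof (induction n arbitrary: k)
  case 0
  then show ?case by (simp add: qpochhammer_def)
next
  case (Suc n)
  let ?R = "qpochhammer x x"
  consider "k = 0" | "k = Suc n" | j where "k = Suc j" "j < n"
    using Suc.prems by (cases k) (auto simp: le_less)
  then show ?case
  proof cases
    case 3
    define d where "d = n - Suc j"
    have n: "n = Suc (j + d)" using 3 by (simp add: d_def)
    from Suc.IH[of j] Suc.IH[of k] n 3(1)
    have d1: "?R j * ?R (Suc d) dvd ?R n" and d2: "?R (Suc j) * ?R d dvd ?R n"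
      by (simp_all add: Suc_diff_le)
    have d1': "?R (Suc j) * ?R (Suc d) dvd ?R n * (1 - x ^ Suc j)"
      using mult_dvd_mono[OF d1 dvd_refl[of "1 - x ^ Suc j"]]
      by (simp only: qpochhammer_Suc[of _ _ j] power_Suc mult_ac)
    have d2': "?R (Suc j) * ?R (Suc d) dvd ?R n * (1 - x ^ Suc d)"
      using mult_dvd_mono[OF d2 dvd_refl[of "1 - x ^ Suc d"]]
      by (simp only: qpochhammer_Suc[of _ _ d] power_Suc mult_ac)
    have "x ^ Suc n = x ^ Suc j * x ^ Suc d"
      by (simp only: n power_add[symmetric] add_Suc add_Suc_right)
    then have "?R (Suc n) = ?R n * (1 - x ^ Suc j * x ^ Suc d)"
      by (simp add: qpochhammer_Suc)
    also have "\<dots> = ?R n * (1 - x ^ Suc j) + x ^ Suc j * (?R n * (1 - x ^ Suc d))"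
      by (simp add: algebra_simps)
    finally have "?R (Suc j) * ?R (Suc d) dvd ?R (Suc n)"
      using d1' d2' by (simp only: dvd_add dvd_mult)
    moreover have "Suc n - k = Suc d" using 3(1) n by simp
    ultimately show ?thesis using 3(1) by simp
  qed (simp_all add: qpochhammer_def)
qed

lemma qbinomial_exact:
  assumes "k \<le> n"
  shows "qbinomial n k * (qpochhammer qX qX k * qpochhammer qX qX (n - k))
    = qpochhammer (qX :: 'a::field poly) qX n"
  unfolding qbinomial_def if_P[OF assms] by (rule dvd_div_mult_self[OF qpochhammer_dvd[OF assms]])

lemma qnumber_exact: "qnumber n * (1 - qX) = (1 - qX ^ n :: 'a::field poly)"
  unfolding qnumber_def one_diff_power_eq by (rule dvd_div_mult_self[OF dvd_triv_left])

lemma qbinomial_2n_Suc: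
  "qbinomial (2 * n) (Suc n) * (1 - qX ^ Suc n) = qbinomial (2 * n) n * (1 - qX ^ n :: 'a::field poly)"
proof (cases n)
  case 0
  show ?thesis unfolding 0 by (simp add: qbinomial_def)
next
  case (Suc l)
  have cancel: "D * y = B * z"
    if "D * ((Rn * y) * Rl) = R2n" "B * (Rn * (Rl * z)) = R2n" "Rn \<noteq> 0" "Rl \<noteq> 0"
    for D B Rn Rl R2n y z :: "'a poly"
  proof -
    have "(Rn * Rl) * (D * y) = (Rn * Rl) * (B * z)"
      using that(1,2) by (simp only: mult_ac)
    with that(3,4) show ?thesis by simp
  qed
  let ?R = "qpochhammer (qX :: 'a poly) qX"
  have R: "?R (Suc i) = ?R i * (1 - qX ^ Suc i)" for i
    by (simp only: qpochhammer_Suc power_Suc)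
  have "2 * n - Suc n = l" "2 * n - n = n" "Suc n \<le> 2 * n" "n \<le> 2 * n" using Suc by simp_all
  then have "qbinomial (2 * n) (Suc n) * (?R (Suc n) * ?R l) = ?R (2 * n)"
    and "qbinomial (2 * n) n * (?R n * ?R n) = ?R (2 * n)"
    using qbinomial_exact[of "Suc n" "2 * n"] qbinomial_exact[of n "2 * n"] by metis+
  moreover have "?R n * ?R n = ?R n * (?R l * (1 - qX ^ n))"
    using R[of l] unfolding Suc by (rule arg_cong)
  ultimately show ?thesis
    using cancel[OF _ _ qpochhammer_qX_neq qpochhammer_qX_neq] unfolding R[of n] by metis
qed

lemma qcatalan_diff_mult:
  "(qbinomial (2 * n) n - qX * qbinomial (2 * n) (n + 1)) * qnumber (n + 1)
    = (qbinomial (2 * n) n :: 'a::field poly)"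
proof -
  have cancel: "(B - x * D) * N = B"
    if "D * (1 - x * y) = B * (1 - y)" "N * (1 - x) = 1 - x * y" "1 - x \<noteq> 0"
    for B D N x y :: "'a poly"
  proof -
    have "(B - x * D) * N * (1 - x) = (B - x * D) * (1 - x * y)"
      using that(2) by (simp only: mult.assoc)
    also have "\<dots> = B * (1 - x * y) - x * (D * (1 - x * y))"
      by (simp only: left_diff_distrib mult.assoc)
    also have "\<dots> = B * (1 - x)"
      unfolding that(1) by (simp add: algebra_simps)
    finally show ?thesis using that(3) by simp
  qed
  have "(1 - qX :: 'a poly) \<noteq> 0" using one_minus_qX_power_neq[of 0] by simp
  with qbinomial_2n_Suc[of n] qnumber_exact[of "Suc n"] show ?thesis
    unfolding Suc_eq_plus1[symmetric] power_Suc by (rule cancel)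
qed

lemma qcatalan_exact: "qcatalan n * qnumber (n + 1) = (qbinomial (2 * n) n :: 'a::field poly)"
  unfolding qcatalan_def
  by (rule dvd_div_mult_self, rule dvdI, rule trans[OF qcatalan_diff_mult[symmetric] mult.commute])

lemma qcatalan_diff:
  "qcatalan n = (qbinomial (2 * n) n - qX * qbinomial (2 * n) (n + 1) :: 'a::field poly)"
proof -
  have "(qnumber (n + 1) :: 'a poly) \<noteq> 0"
  proof
    assume "(qnumber (n + 1) :: 'a poly) = 0"
    with qnumber_exact[of "Suc n", where ?'a = 'a] have "(1 - qX ^ Suc n :: 'a poly) = 0"
      by (simp only: Suc_eq_plus1 mult_zero_left)
    with one_minus_qX_power_neq show False by blast
  qed
  then show ?thesis
    by (rule mult_right_cancel[THEN iffD1, OF _ trans[OF qcatalan_exact qcatalan_diff_mult[symmetric]]])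
qed

definition catalan :: "nat \<Rightarrow> rat" where
  "catalan n = 1 / of_nat (n + 1) * of_nat ((2 * n) choose n)"

definition p_integral :: "nat \<Rightarrow> rat \<Rightarrow> bool" where
  "p_integral p x \<longleftrightarrow> coprime (snd (quotient_of x)) (int p)"

text \<open>Congruence modulo \<open>p\<close> in the ring of rationals whose denominator is prime to \<open>p\<close>.\<close>

definition rat_cong :: "nat \<Rightarrow> rat \<Rightarrow> rat \<Rightarrow> bool" where
  "rat_cong p x y \<longleftrightarrow>
     p_integral p x \<and> p_integral p y \<and> (\<exists>z. p_integral p z \<and> x - y = of_nat p * z)"

end

theory Submission
  imports Defs
begin

text \<open>
  Write \<open>[n, k]\<close> for the \<open>q\<close>-binomial coefficient. The two \<open>q\<close>-Pascal rules give, with explicit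
  exponents \<open>e(j)\<close>, the finite identity
  \[ \sum_{k<n} q^k [2k, k+d] = \sum_{j>d} \left(\frac{j-d}{3}\right) q^{e(j)} [2n, n+j], \]
  because increasing \<open>n\<close> by one changes the right-hand side by a telescoping sum with boundary
  term \<open>q^n [2n, n+d]\<close>. If \<open>q\<close> is a primitive \<open>n\<close>-th root of unity, or if \<open>q = 1\<close> and \<open>n = p^a\<close> is
  considered modulo \<open>p\<close>, then every coefficient with \<open>0 < j < n\<close> vanishes and only \<open>j = n\<close> survives.
  Both claims follow from the cases \<open>d = 0\<close> and \<open>d = 1\<close>, as the \<open>k\<close>-th \<open>q\<close>-Catalan number is
  \<open>[2k, k] - q [2k, k+1]\<close>.
\<close>

locale q_pascal =
  fixes q :: "'a::comm_ring_1" and g :: "nat \<Rightarrow> nat \<Rightarrow> 'a"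
  assumes g_zero: "n < k \<Longrightarrow> g n k = 0"
    and g_diag: "g n n = 1"
    and pascal1: "g (Suc n) (Suc k) = g n k + q ^ Suc k * g n (Suc k)"
    and pascal2: "k \<le> n \<Longrightarrow> g (Suc n) (Suc k) = q ^ (n - k) * g n k + g n (Suc k)"
begin

lemma ratio: "k \<le> n \<Longrightarrow> (1 - q ^ (n - k)) * g n k = (1 - q ^ Suc k) * g n (Suc k)"
  using pascal1[of n k] pascal2[of k n] by (simp add: algebra_simps)

lemma pascal2_mult: "q ^ k * g (Suc n) (Suc k) = q ^ n * g n k + q ^ k * g n (Suc k)"
proof (cases "k \<le> n")
  case True
  then have "q ^ n = q ^ k * q ^ (n - k)" by (simp flip: power_add)
  with pascal2[OF True] show ?thesis by (simp add: algebra_simps)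
qed (simp add: g_zero)

lemma central_ratio:
  "(q ^ j - q ^ n) * g (2 * n) (n + j) = q ^ j * (1 - q ^ (n + j + 1)) * g (2 * n) (n + j + 1)"
proof (cases "j \<le> n")
  case True
  then have "q ^ n = q ^ j * q ^ (n - j)" by (simp flip: power_add)
  moreover have "(1 - q ^ (n - j)) * g (2 * n) (n + j) = (1 - q ^ (n + j + 1)) * g (2 * n) (n + j + 1)"
    using ratio[of "n + j" "2 * n"] True by simp
  then have "q ^ j * ((1 - q ^ (n - j)) * g (2 * n) (n + j))
      = q ^ j * ((1 - q ^ (n + j + 1)) * g (2 * n) (n + j + 1))"
    by (rule arg_cong)
  ultimately show ?thesis by (simp only: right_diff_distrib mult.assoc mult_1_right flip: mult.assoc)
qed (simp add: g_zero)

lemma central_pascal: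
  "q ^ j * g (2 * Suc n) (Suc n + (j + 1))
     = q ^ n * g (2 * n) (n + j)
       + q ^ j * (1 + q ^ (2 * n + 1)) * g (2 * n) (n + j + 1)
       + q ^ (n + 2 * j + 2) * g (2 * n) (n + j + 2)"
proof (cases "j \<le> n")
  case True
  then have "q ^ n = q ^ j * q ^ (n - j)" by (simp flip: power_add)
  with pascal2[of "n + j" "2 * n"] True
  have lower: "q ^ j * g (Suc (2 * n)) (Suc (n + j))
      = q ^ n * g (2 * n) (n + j) + q ^ j * g (2 * n) (n + j + 1)"
    by (simp add: algebra_simps)
  have "q ^ (n + 2 * j + 2) * g (Suc (2 * n)) (n + j + 2)
      = q ^ (j + 1) * (q ^ Suc (n + j) * g (Suc (2 * n)) (Suc (Suc (n + j))))"
    by (simp add: power_add mult_2 mult_2_right mult_ac)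
  also have "\<dots> = q ^ (j + 2 * n + 1) * g (2 * n) (n + j + 1)
      + q ^ (n + 2 * j + 2) * g (2 * n) (n + j + 2)"
    unfolding pascal2_mult by (simp add: power_add mult_2 mult_2_right algebra_simps)
  finally have upper: "q ^ (n + 2 * j + 2) * g (Suc (2 * n)) (n + j + 2)
      = q ^ (j + 2 * n + 1) * g (2 * n) (n + j + 1)
        + q ^ (n + 2 * j + 2) * g (2 * n) (n + j + 2)" .
  have "q ^ j * g (2 * Suc n) (Suc n + (j + 1))
      = q ^ j * g (Suc (Suc (2 * n))) (Suc (Suc (n + j)))" by simp
  also have "\<dots> = q ^ j * g (Suc (2 * n)) (Suc (n + j))
      + q ^ (n + 2 * j + 2) * g (Suc (2 * n)) (n + j + 2)"
    unfolding pascal1[of "Suc (2 * n)"]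
    by (simp add: power_add mult_2 mult_2_right algebra_simps)
  finally show ?thesis
    unfolding lower upper by (simp add: power_add algebra_simps)
qed (simp add: g_zero)

text \<open>
  The exponents are the ones for which the terms with \<open>j + 1\<close> and \<open>j + 2\<close> cancel through
  \<open>central_ratio\<close>.
\<close>

lemma triple_step:
  fixes n u j :: nat
  defines "F \<equiv> \<lambda>n. q ^ (u + j) * g (2 * n) (n + (j + 1)) - q ^ (u + 3 * j + 3) * g (2 * n) (n + (j + 2))"
  shows "F (Suc n) - F n
    = q ^ n * (q ^ u * g (2 * n) (n + j) - q ^ (u + 4 * j + 6) * g (2 * n) (n + (j + 3)))"
proof -
  have "F (Suc n) = q ^ u * (q ^ j * g (2 * Suc n) (Suc n + (j + 1)))
      - q ^ (u + 2 * j + 2) * (q ^ (j + 1) * g (2 * Suc n) (Suc n + (j + 1 + 1)))"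
    by (simp add: F_def power_add numeral_eq_Suc mult_ac)
  also have "\<dots> - F n
    = q ^ n * (q ^ u * g (2 * n) (n + j) - q ^ (u + 4 * j + 6) * g (2 * n) (n + (j + 3)))
      - q ^ (u + n + j + 1) * ((q ^ (j + 1) - q ^ n) * g (2 * n) (n + (j + 1))
          - q ^ (j + 1) * (1 - q ^ (n + (j + 1) + 1)) * g (2 * n) (n + (j + 1) + 1))"
    unfolding central_pascal F_def
    by (simp add: power_add algebra_simps power_mult numeral_eq_Suc)
  finally show ?thesis unfolding central_ratio by simp
qed

lemma central_sum:
  fixes d :: nat
  defines "u \<equiv> \<lambda>t. 2 * t * (2 * d + 3 * t)"
  assumes "n \<le> T"
  shows "(\<Sum>k<n. q ^ k * g (2 * k) (k + d))
    = (\<Sum>t<T. q ^ (u t + (d + 3 * t)) * g (2 * n) (n + ((d + 3 * t) + 1))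
        - q ^ (u t + 3 * (d + 3 * t) + 3) * g (2 * n) (n + ((d + 3 * t) + 2)))"
  using assms(2)
proof (induction n)
  case 0
  show ?case by (simp add: g_zero)
next
  case (Suc n)
  let ?F = "\<lambda>n t. q ^ (u t + (d + 3 * t)) * g (2 * n) (n + ((d + 3 * t) + 1))
        - q ^ (u t + 3 * (d + 3 * t) + 3) * g (2 * n) (n + ((d + 3 * t) + 2))"
  let ?H = "\<lambda>t. q ^ u t * g (2 * n) (n + (d + 3 * t))"
  have "(\<Sum>t<T. ?F (Suc n) t) - (\<Sum>t<T. ?F n t) = (\<Sum>t<T. ?F (Suc n) t - ?F n t)"
    by (simp add: sum_subtractf)
  also have "\<dots> = (\<Sum>t<T. q ^ n * (?H t - ?H (Suc t)))"
  proof (rule sum.cong[OF refl])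
    fix t
    have "u (Suc t) = u t + 4 * (d + 3 * t) + 6" by (simp add: u_def algebra_simps)
    then show "?F (Suc n) t - ?F n t = q ^ n * (?H t - ?H (Suc t))"
      unfolding triple_step by (simp add: add_ac)
  qed
  also have "\<dots> = q ^ n * (?H 0 - ?H T)"
    unfolding sum_distrib_left[symmetric] sum_lessThan_telescope'[of ?H T] ..
  also have "?H T = 0" using Suc.prems by (simp add: g_zero)
  finally show ?case using Suc by (simp add: u_def algebra_simps)
qed

text \<open>The divisor \<open>c\<close> is \<open>0\<close> at a root of unity and \<open>p\<close> for the congruence.\<close>

lemma central_sum_dvd:
  assumes van: "\<And>k. n < k \<Longrightarrow> k < 2 * n \<Longrightarrow> c dvd g (2 * n) k"
    and uu: "\<And>t. u t = 2 * t * (2 * d + 3 * t)"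
  shows "c dvd (\<Sum>k<n. q ^ k * g (2 * k) (k + d))
    - ((\<Sum>t | n = d + 3 * t + 1. q ^ (u t + (d + 3 * t)))
       - (\<Sum>t | n = d + 3 * t + 2. q ^ (u t + 3 * (d + 3 * t) + 3)))"
proof -
  have van': "c dvd g (2 * n) (n + Suc k) - (if n = Suc k then 1 else 0)" for k
    using van[of "n + Suc k"] by (cases "Suc k < n") (auto simp: g_zero g_diag mult_2)
  have part: "c dvd (\<Sum>t<n. q ^ e t * g (2 * n) (n + Suc (d + 3 * t + r)))
      - (\<Sum>t | n = Suc (d + 3 * t + r). q ^ e t)" for e r
  proof -
    have "(\<Sum>t | n = Suc (d + 3 * t + r). q ^ e t)
        = (\<Sum>t<n. q ^ e t * (if n = Suc (d + 3 * t + r) then 1 else 0))"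
      by (rule sum.mono_neutral_cong_left) auto
    then have "(\<Sum>t<n. q ^ e t * g (2 * n) (n + Suc (d + 3 * t + r)))
        - (\<Sum>t | n = Suc (d + 3 * t + r). q ^ e t)
      = (\<Sum>t<n. q ^ e t * (g (2 * n) (n + Suc (d + 3 * t + r))
          - (if n = Suc (d + 3 * t + r) then 1 else 0)))"
      by (simp add: sum_subtractf right_diff_distrib)
    also have "c dvd \<dots>" by (intro dvd_sum dvd_mult van')
    finally show ?thesis .
  qed
  have "c dvd ((\<Sum>t<n. q ^ (u t + (d + 3 * t)) * g (2 * n) (n + Suc (d + 3 * t + 0)))
        - (\<Sum>t | n = Suc (d + 3 * t + 0). q ^ (u t + (d + 3 * t))))
      - ((\<Sum>t<n. q ^ (u t + 3 * (d + 3 * t) + 3) * g (2 * n) (n + Suc (d + 3 * t + 1)))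
        - (\<Sum>t | n = Suc (d + 3 * t + 1). q ^ (u t + 3 * (d + 3 * t) + 3)))"
    by (rule dvd_diff[OF part part])
  then show ?thesis
    unfolding central_sum[OF order_refl]
    by (simp add: sum_subtractf uu algebra_simps)
qed

end

lemma central_coeff_zero:
  fixes q :: "'a::idom"
  assumes "q_pascal q g" and root: "q ^ n = 1" and prim: "\<And>j. 0 < j \<Longrightarrow> j < n \<Longrightarrow> q ^ j \<noteq> 1"
    and "0 < j" "j < n"
  shows "g (2 * n) (2 * n - j) = 0"
proof -
  interpret q_pascal q g by fact
  have q2n: "q ^ (2 * n) = 1" using root by (simp add: mult_2 power_add)
  show ?thesis using assms(4,5)
  proof (induction j)
    case (Suc j)
    have S: "Suc (2 * n - Suc j) = 2 * n - j" using Suc.prems by simp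
    have "(1 - q ^ Suc (2 * n - Suc j)) * g (2 * n) (Suc (2 * n - Suc j)) = 0"
      unfolding S using Suc q2n by (cases j) auto
    moreover have "2 * n - (2 * n - Suc j) = Suc j" using Suc.prems by simp
    ultimately have "(1 - q ^ Suc j) * g (2 * n) (2 * n - Suc j) = 0"
      using ratio[of "2 * n - Suc j" "2 * n"] by (metis diff_le_self)
    moreover have "1 - q ^ Suc j \<noteq> 0" using prim[of "Suc j"] Suc.prems by (metis right_minus_eq)
    ultimately show ?case by simp
  qed simp
qed

lemma qbinomial_eq_0: "n < k \<Longrightarrow> qbinomial n k = 0"
  by (simp add: qbinomial_def)

lemma qbinomial_self: "qbinomial n n = (1 :: 'a::field poly)"
proof -
  have "qpochhammer qX qX 0 = (1 :: 'a poly)" by (simp add: qpochhammer_def)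
  then show ?thesis
    using qpochhammer_qX_neq[of n, where ?'a = 'a] by (simp add: qbinomial_def)
qed

lemma q_pascal_qbinomial: "q_pascal (qX :: 'a::field poly) qbinomial"
proof
  fix n k :: nat
  let ?R = "qpochhammer (qX :: 'a poly) qX"
  let ?B = "qbinomial :: nat \<Rightarrow> nat \<Rightarrow> 'a poly"
  show "?B n k = 0" if "n < k" using that by (rule qbinomial_eq_0)
  show "?B n n = 1" by (rule qbinomial_self)
  have R: "?R (Suc i) = ?R i * (1 - qX ^ Suc i)" for i
    by (simp only: qpochhammer_Suc power_Suc)
  have rec: "?B (Suc n) (Suc k) = ?B n k + qX ^ Suc k * ?B n (Suc k)
      \<and> ?B (Suc n) (Suc k) = qX ^ (n - k) * ?B n k + ?B n (Suc k)" if "k < n"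
  proof -
    have n: "n - k = Suc (n - Suc k)" using that by simp
    define x y where "x = (qX ^ Suc k :: 'a poly)" and "y = (qX ^ (n - k) :: 'a poly)"
    define C where "C = ?R k * ?R (n - Suc k)"
    have Rk: "?R (Suc k) = ?R k * (1 - x)" unfolding R x_def ..
    have Rd: "?R (n - k) = ?R (n - Suc k) * (1 - y)" unfolding y_def n R ..
    have xy: "qX ^ Suc n = x * y" using that by (simp add: x_def y_def flip: power_add power_Suc)
    have "?B (Suc n) (Suc k) * (?R (Suc k) * ?R (n - k)) = ?R n * (1 - x * y)"
      using qbinomial_exact[of "Suc k" "Suc n", where ?'a = 'a] that unfolding R[of n] xy by simp
    then have 0: "?B (Suc n) (Suc k) * (C * (1 - x) * (1 - y)) = ?R n * (1 - x * y)"
      unfolding Rk Rd C_def by (simp only: mult_ac)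
    have 1: "?B n k * (C * (1 - y)) = ?R n"
      using qbinomial_exact[of k n, where ?'a = 'a] that unfolding Rd C_def by (simp add: mult_ac)
    have 2: "?B n (Suc k) * (C * (1 - x)) = ?R n"
      using qbinomial_exact[of "Suc k" n, where ?'a = 'a] that unfolding Rk C_def by (simp add: mult_ac)
    have "C * (1 - x) * (1 - y) \<noteq> 0"
      unfolding C_def x_def y_def n
      using qpochhammer_qX_neq[where ?'a = 'a] one_minus_qX_power_neq[where ?'a = 'a]
      by (simp only: mult_eq_0_iff) blast
    moreover have "(?B n k + x * ?B n (Suc k)) * (C * (1 - x) * (1 - y)) = ?R n * (1 - x * y)"
    proof -
      have "(?B n k + x * ?B n (Suc k)) * (C * (1 - x) * (1 - y))
          = (?B n k * (C * (1 - y))) * (1 - x) + x * (?B n (Suc k) * (C * (1 - x))) * (1 - y)"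
        by (simp add: algebra_simps)
      also have "\<dots> = ?R n * (1 - x * y)" unfolding 1 2 by (simp only: algebra_simps) simp
      finally show ?thesis .
    qed
    moreover have "(y * ?B n k + ?B n (Suc k)) * (C * (1 - x) * (1 - y)) = ?R n * (1 - x * y)"
    proof -
      have "(y * ?B n k + ?B n (Suc k)) * (C * (1 - x) * (1 - y))
          = y * (?B n k * (C * (1 - y))) * (1 - x) + (?B n (Suc k) * (C * (1 - x))) * (1 - y)"
        by (simp add: algebra_simps)
      also have "\<dots> = ?R n * (1 - x * y)" unfolding 1 2 by (simp only: algebra_simps) simp
      finally show ?thesis .
    qed
    ultimately show ?thesis using 0 unfolding x_def y_def by (metis mult_right_cancel)
  qed
  show "?B (Suc n) (Suc k) = ?B n k + qX ^ Suc k * ?B n (Suc k)"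
  proof (cases n k rule: linorder_cases)
    case greater
    then show ?thesis using rec by blast
  next
    case equal
    then show ?thesis by (simp add: qbinomial_self qbinomial_eq_0)
  qed (simp add: qbinomial_eq_0)
  show "?B (Suc n) (Suc k) = qX ^ (n - k) * ?B n k + ?B n (Suc k)" if "k \<le> n"
  proof (cases "k = n")
    case True
    then show ?thesis by (simp add: qbinomial_self qbinomial_eq_0)
  next
    case False
    with that have "k < n" by simp
    then show ?thesis using rec by blast
  qed
qed

lemma q_pascal_poly:
  assumes "q_pascal p g"
  shows "q_pascal (poly p z) (\<lambda>n k. poly (g n k) z)"
proof -
  interpret q_pascal p g by fact
  show ?thesis
    by standard (simp_all add: g_zero g_diag pascal1 flip: pascal2, metis pascal1 pascal2 poly_add poly_mult poly_power power_Suc)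
qed

lemma q_pascal_binomial: "q_pascal (1::int) (\<lambda>n k. int (n choose k))"
  by standard simp_all

lemma Legendre_3:
  "Legendre m 3 = (if 3 dvd m then 0 else if m mod 3 = 1 then 1 else - 1)"
proof -
  have "QuadRes 3 m \<longleftrightarrow> m mod 3 = 1" if "\<not> 3 dvd m"
  proof
    assume "QuadRes 3 m"
    then obtain y where "y\<^sup>2 mod 3 = m mod 3" by (auto simp: QuadRes_def cong_def)
    then have y: "m mod 3 = (y mod 3)\<^sup>2 mod 3" unfolding power_mod by (rule sym)
    have "m mod 3 \<noteq> 0" using that by (simp add: dvd_eq_mod_eq_0)
    moreover have "y mod 3 = 0 \<or> y mod 3 = 1 \<or> y mod 3 = 2" by presburger
    ultimately show "m mod 3 = 1" unfolding y by (elim disjE) simp_all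
  next
    assume "m mod 3 = 1"
    then have "1\<^sup>2 mod 3 = m mod 3" by simp
    then show "QuadRes 3 m" unfolding QuadRes_def cong_def by blast
  qed
  then show ?thesis unfolding Legendre_def cong_0_iff by presburger
qed

lemma exp_int_third:
  assumes "\<not> 3 dvd m"
  shows "exp (2 * of_real pi * of_int m * \<i> / 3)
    = 1 / 2 * (\<i> * of_real (sqrt 3) * of_int (Legendre m 3) - 1)"
proof -
  have per: "exp (2 * of_real pi * of_int (3 * k + r) * \<i> / 3) = cis (2 * pi * of_int r / 3)"
    for k r :: int
  proof -
    have "exp (2 * of_real pi * of_int (3 * k + r) * \<i> / 3)
        = cis (2 * pi * of_int k) * cis (2 * pi * of_int r / 3)"
      unfolding cis_conv_exp exp_add[symmetric] by (rule arg_cong) (simp add: field_simps)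
    then show ?thesis by simp
  qed
  consider k where "m = 3 * k + 1" | k where "m = 3 * k + - 1"
    using assms by atomize_elim presburger
  then show ?thesis
  proof cases
    case 1
    then have L: "Legendre m 3 = 1" using assms by (simp add: Legendre_3)
    show ?thesis unfolding L unfolding 1 per by (simp add: complex_eq_iff cos_120 sin_120)
  next
    case 2
    then have "m mod 3 \<noteq> 1" by presburger
    then have L: "Legendre m 3 = - 1" using assms by (simp add: Legendre_3)
    show ?thesis unfolding L unfolding 2 per by (simp add: complex_eq_iff cos_120 sin_120)
  qed
qed

lemma exp_root_of_unity_power:
  assumes "n \<ge> 1"
  shows "exp (2 * of_real pi * of_int m * \<i> / of_nat n) ^ j = 1 \<longleftrightarrow> int n dvd m * int j"
proof -
  let ?x = "2 * pi * of_int (m * int j) / of_nat n"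
  have "exp (2 * of_real pi * of_int m * \<i> / of_nat n) ^ j = cis ?x"
    unfolding exp_of_nat_mult[symmetric] cis_conv_exp by (rule arg_cong) (simp add: field_simps)
  moreover have "cis ?x = 1 \<longleftrightarrow> (\<exists>i::int. ?x = of_int i * 2 * pi)"
  proof
    assume "cis ?x = 1"
    then have "cos ?x = 1" by (metis Re_complex_of_real cis.sel(1) one_complex.sel(1))
    then show "\<exists>i::int. ?x = of_int i * 2 * pi" by (simp only: cos_one_2pi_int)
  next
    assume "\<exists>i::int. ?x = of_int i * 2 * pi"
    then obtain i :: int where "?x = of_int i * 2 * pi" ..
    then have i: "?x = 2 * pi * of_int i" by (simp only: mult_ac)
    show "cis ?x = 1" unfolding i by simp
  qed
  moreover have "?x = of_int i * 2 * pi \<longleftrightarrow> m * int j = int n * i" for i :: int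
  proof -
    have "?x = of_int i * 2 * pi \<longleftrightarrow> real_of_int (m * int j) = real_of_int (int n * i)"
      using assms by (simp add: field_simps)
    then show ?thesis by (simp only: of_int_eq_iff)
  qed
  ultimately show ?thesis by (auto simp: dvd_def)
qed

lemma solutions_empty:
  fixes n :: nat
  assumes "n mod 3 \<noteq> (d + r) mod 3"
  shows "{t. n = d + 3 * t + r} = {}"
proof -
  have "n \<noteq> d + 3 * t + r" for t using assms by presburger
  then show ?thesis by blast
qed

lemma qcatalan_sum_root_of_unity:
  fixes q :: complex
  assumes root: "q ^ (3 * s + 3) = 1"
    and prim: "\<And>j. 0 < j \<Longrightarrow> j < 3 * s + 3 \<Longrightarrow> q ^ j \<noteq> 1"
  shows "(\<Sum>k<3 * s + 3. q ^ k * poly (qcatalan k) q) = q ^ (s + 1)"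
proof -
  define n where "n = 3 * s + 3"
  let ?g = "\<lambda>n k. poly (qbinomial n k) q"
  interpret q_pascal q ?g
    using q_pascal_poly[OF q_pascal_qbinomial, of q] by simp
  have van: "0 dvd ?g (2 * n) k" if "n < k" "k < 2 * n" for k
    using central_coeff_zero[OF q_pascal_axioms, of n "2 * n - k"] root prim that
    by (simp add: n_def)
  have S0: "(\<Sum>k<n. q ^ k * ?g (2 * k) k) = 0"
  proof -
    have "{t. n = 0 + 3 * t + 1} = {}" "{t. n = 0 + 3 * t + 2} = {}"
      unfolding n_def by (rule solutions_empty; presburger)+
    then show ?thesis using central_sum_dvd[where c = 0 and d = 0, OF van refl] by simp
  qed
  have S1: "(\<Sum>k<n. q ^ k * ?g (2 * k) (k + 1))
      = - (q ^ (2 * s * (2 * 1 + 3 * s) + 3 * (1 + 3 * s) + 3))"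
  proof -
    have "{t. n = 1 + 3 * t + 1} = {}"
      unfolding n_def by (rule solutions_empty; presburger)
    moreover have "{t. n = 1 + 3 * t + 2} = {s}" by (auto simp: n_def)
    ultimately show ?thesis
      using central_sum_dvd[where c = 0 and d = 1, OF van refl] by (simp add: add_eq_0_iff2)
  qed
  have "(\<Sum>k<n. q ^ k * poly (qcatalan k) q)
      = (\<Sum>k<n. q ^ k * ?g (2 * k) k) - q * (\<Sum>k<n. q ^ k * ?g (2 * k) (k + 1))"
    unfolding qcatalan_diff
    by (simp add: sum_subtractf sum_distrib_left right_diff_distrib mult_ac)
  also have "\<dots> = q * q ^ (2 * s * (2 * 1 + 3 * s) + 3 * (1 + 3 * s) + 3)"
    unfolding S0 S1 by simp
  also have "\<dots> = q ^ ((s + 1) + (3 * s + 3) * (2 * s + 2))"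
    unfolding power_Suc[symmetric] by (rule arg_cong) (simp add: algebra_simps)
  also have "\<dots> = q ^ (s + 1)"
    unfolding power_add[of q "s + 1"] power_mult[of q "3 * s + 3"] root by simp
  finally show ?thesis unfolding n_def .
qed

lemma prime_dvd_central_choose:
  assumes p: "prime p" and k: "p ^ a < k" "k < 2 * p ^ a"
  shows "p dvd (2 * p ^ a choose k)"
proof (rule ccontr)
  assume "\<not> p dvd (2 * p ^ a choose k)"
  then have "coprime (p ^ a) (2 * p ^ a choose k)"
    using p by (simp add: prime_imp_coprime)
  moreover have "p ^ a dvd k * (2 * p ^ a choose k)"
    using k by (simp add: times_binomial_minus1_eq)
  ultimately have "p ^ a dvd k" by (simp add: coprime_dvd_mult_left_iff)
  then obtain c where "k = p ^ a * c" ..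
  with k have "1 < c" "c < 2" by simp_all
  then show False by simp
qed

lemma catalan_diff: "catalan k = of_int (int (2 * k choose k) - int (2 * k choose (k + 1)))"
proof -
  have "Suc k * (2 * k choose Suc k) = k * (2 * k choose k)"
    unfolding binomial_absorption using binomial_absorb_comp[of "2 * k" k] by (metis add_diff_cancel_left' mult_2)
  then have "rat_of_nat (k + 1) * of_nat (2 * k choose (k + 1)) = of_nat k * of_nat (2 * k choose k)"
    unfolding of_nat_mult[symmetric] by simp
  then show ?thesis by (simp add: catalan_def field_simps)
qed

lemma pos_mod3_cases:
  "0 < (n::nat) \<Longrightarrow> (\<exists>s. n = 3 * s + 1) \<or> (\<exists>s. n = 3 * s + 2) \<or> (\<exists>s. n = 3 * s + 3)"
  by presburger

lemma catalan_sum_dvd: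
  assumes "prime p"
  shows "int p dvd (\<Sum>k<p ^ a. int (2 * k choose k) - int (2 * k choose (k + 1)))
    - (if p ^ a mod 3 = 2 then - 2 else 1)"
proof -
  let ?n = "p ^ a"
  interpret q_pascal "1::int" "\<lambda>n k. int (n choose k)" by (rule q_pascal_binomial)
  have van: "int p dvd int (2 * ?n choose k)" if "?n < k" "k < 2 * ?n" for k
    using prime_dvd_central_choose[OF assms that] by simp
  have S: "int p dvd (\<Sum>k<?n. int (2 * k choose (k + d)))
      - (int (card {t. ?n = d + 3 * t + 1}) - int (card {t. ?n = d + 3 * t + 2}))" for d
    using central_sum_dvd[of ?n "int p", OF van refl, of d] by simp
  have "int p dvd ((\<Sum>k<?n. int (2 * k choose (k + 0)))
      - (int (card {t. ?n = 0 + 3 * t + 1}) - int (card {t. ?n = 0 + 3 * t + 2})))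
    - ((\<Sum>k<?n. int (2 * k choose (k + 1)))
      - (int (card {t. ?n = 1 + 3 * t + 1}) - int (card {t. ?n = 1 + 3 * t + 2})))" (is "_ dvd ?D")
    by (rule dvd_diff[OF S S])
  also have "?D = (\<Sum>k<?n. int (2 * k choose k) - int (2 * k choose (k + 1)))
    - ((int (card {t. ?n = 0 + 3 * t + 1}) - int (card {t. ?n = 0 + 3 * t + 2}))
      - (int (card {t. ?n = 1 + 3 * t + 1}) - int (card {t. ?n = 1 + 3 * t + 2})))"
    by (simp add: sum_subtractf)
  also have "(int (card {t. ?n = 0 + 3 * t + 1}) - int (card {t. ?n = 0 + 3 * t + 2}))
      - (int (card {t. ?n = 1 + 3 * t + 1}) - int (card {t. ?n = 1 + 3 * t + 2}))
    = (if ?n mod 3 = 2 then - 2 else 1)"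
  proof -
    have "?n > 0" using assms by (simp add: prime_gt_0_nat)
    then consider s where "?n = 3 * s + 1" | s where "?n = 3 * s + 2" | s where "?n = 3 * s + 3"
      using pos_mod3_cases by blast
    then show ?thesis
    proof cases
      case (1 s)
      have "{t. ?n = 0 + 3 * t + 2} = {}" "{t. ?n = 1 + 3 * t + 1} = {}" "{t. ?n = 1 + 3 * t + 2} = {}"
        unfolding 1 by (rule solutions_empty; presburger)+
      moreover have "{t. ?n = 0 + 3 * t + 1} = {s}"
        unfolding 1 by auto
      moreover have "?n mod 3 \<noteq> 2" unfolding 1 by presburger
      ultimately show ?thesis by simp
    next
      case (2 s)
      have "{t. ?n = 0 + 3 * t + 1} = {}" "{t. ?n = 1 + 3 * t + 2} = {}"
        unfolding 2 by (rule solutions_empty; presburger)+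
      moreover have "{t. ?n = 0 + 3 * t + 2} = {s}" "{t. ?n = 1 + 3 * t + 1} = {s}"
        unfolding 2 by auto
      moreover have "?n mod 3 = 2" unfolding 2 by presburger
      ultimately show ?thesis by simp
    next
      case (3 s)
      have "{t. ?n = 0 + 3 * t + 1} = {}" "{t. ?n = 0 + 3 * t + 2} = {}" "{t. ?n = 1 + 3 * t + 1} = {}"
        unfolding 3 by (rule solutions_empty; presburger)+
      moreover have "{t. ?n = 1 + 3 * t + 2} = {s}"
        unfolding 3 by auto
      moreover have "?n mod 3 \<noteq> 2" unfolding 3 by presburger
      ultimately show ?thesis by simp
    qed
  qed
  finally show ?thesis .
qed

lemma p_integralI:
  assumes "x * of_int b = of_int c" "coprime b (int p)"
  shows "p_integral p x"
proof -
  obtain r s where rs: "quotient_of x = (r, s)" by (cases "quotient_of x")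
  then have s: "s > 0" and co: "coprime r s" and x: "x = of_int r / of_int s"
    by (auto simp: quotient_of_denom_pos quotient_of_coprime quotient_of_div)
  have "rat_of_int (r * b) = of_int (c * s)"
    using assms(1) s unfolding x by (simp add: field_simps)
  then have "r * b = c * s" by (simp only: of_int_eq_iff)
  then have "s dvd r * b" by simp
  with co have "s dvd b" by (simp add: coprime_commute coprime_dvd_mult_right_iff)
  then show ?thesis using assms(2) rs
    by (auto simp: p_integral_def intro: coprime_divisors[OF _ dvd_refl])
qed

lemma p_integral_of_int: "p_integral p (of_int c)"
  by (rule p_integralI[of _ 1 c]) simp_all

lemma catalan_sum_rat_cong:
  assumes p: "prime p"
  shows "rat_cong p (\<Sum>k<p ^ a. catalan k) (1 / 2 * (3 * of_int (Legendre (int (p ^ a)) 3) - 1))"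
proof -
  define S where "S = (\<Sum>k<p ^ a. int (2 * k choose k) - int (2 * k choose (k + 1)))"
  have S: "(\<Sum>k<p ^ a. catalan k) = of_int S" by (simp add: S_def catalan_diff)
  obtain c where c: "S - (if p ^ a mod 3 = 2 then - 2 else 1) = int p * c"
    using catalan_sum_dvd[OF p, of a] unfolding S_def by (elim dvdE)
  show ?thesis
  proof (cases "3 dvd p ^ a")
    case True
    then have "3 dvd p" by (rule prime_dvd_power[rotated]) simp
    then have p3: "p = 3" using p primes_dvd_imp_eq[of 3 p] by simp
    have L: "Legendre (int (p ^ a)) 3 = 0"
      using True unfolding Legendre_3 by (metis of_nat_dvd_iff of_nat_numeral)
    have S3: "rat_of_int S = 1 + 3 * of_int c"
    proof -
      have "S = 1 + 3 * c" using c True unfolding p3 dvd_eq_mod_eq_0 by simp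
      then show ?thesis by simp
    qed
    have "p_integral p (- 1 / 2)"
      by (rule p_integralI[of _ 2 "- 1"]) (simp_all add: p3)
    moreover have "p_integral p (of_int c + 1 / 2)"
      by (rule p_integralI[of _ 2 "2 * c + 1"]) (simp_all add: p3 field_simps)
    moreover have "of_int S - - 1 / 2 = rat_of_nat p * (of_int c + 1 / 2)"
      unfolding S3 p3 by simp
    moreover have "1 / 2 * (3 * of_int 0 - 1) = (- 1 / 2 :: rat)" by simp
    ultimately show ?thesis
      unfolding rat_cong_def S L using p_integral_of_int by metis
  next
    case False
    define v :: int where "v = (if p ^ a mod 3 = 2 then - 2 else 1)"
    have "p ^ a mod 3 = 1 \<or> p ^ a mod 3 = 2" using False by (simp only: dvd_eq_mod_eq_0) linarith
    moreover have "int (p ^ a) mod 3 = int (p ^ a mod 3)" by (simp only: zmod_int of_nat_numeral)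
    ultimately have v: "1 / 2 * (3 * rat_of_int (Legendre (int (p ^ a)) 3) - 1) = of_int v"
      using False by (auto simp: Legendre_3 v_def dvd_eq_mod_eq_0)
    have "rat_of_int S - of_int v = of_nat p * of_int c"
      using c unfolding v_def[symmetric] by (metis of_int_diff of_int_mult of_int_of_nat_eq)
    then show ?thesis
      unfolding rat_cong_def S v using p_integral_of_int by blast
  qed
qed

theorem corollary6p2:
  "(\<forall>(n::nat) (m::int) (q::complex).
      n \<ge> 1 \<longrightarrow> coprime (int n) m \<longrightarrow>
      q = exp (2 * of_real pi * of_int m * \<i> / of_nat n) \<longrightarrow> 3 dvd n \<longrightarrow>
      (\<Sum>k=0..n-1. q ^ k * poly (qcatalan k) q)
        = 1 / 2 * (\<i> * of_real (sqrt 3) * of_int (Legendre m 3) - 1)) \<and>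
   (\<forall>(p::nat) (a::nat).
      prime p \<longrightarrow> a > 0 \<longrightarrow>
      rat_cong p (\<Sum>k=0..p^a-1. catalan k)
        (1 / 2 * (3 * of_int (Legendre (int (p ^ a)) 3) - 1)))"
proof (intro conjI allI impI)
  fix n :: nat and m :: int and q :: complex
  assume n: "n \<ge> 1" and co: "coprime (int n) m"
    and q: "q = exp (2 * of_real pi * of_int m * \<i> / of_nat n)" and "3 dvd n"
  from \<open>3 dvd n\<close> n obtain s where s: "n = 3 * s + 3" by atomize_elim presburger
  have pow: "q ^ j = 1 \<longleftrightarrow> n dvd j" for j
    unfolding q exp_root_of_unity_power[OF n] using co by (simp add: coprime_dvd_mult_right_iff)
  have "\<not> 3 dvd m"
  proof
    assume "3 dvd m"
    moreover have "3 dvd int n" using \<open>3 dvd n\<close> by presburger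
    ultimately show False using coprime_common_divisor[OF co, of 3] by simp
  qed
  have "(\<Sum>k=0..n-1. q ^ k * poly (qcatalan k) q) = (\<Sum>k<3 * s + 3. q ^ k * poly (qcatalan k) q)"
    using s by (intro sum.cong) auto
  also have "\<dots> = q ^ (s + 1)"
    by (rule qcatalan_sum_root_of_unity) (use pow s in \<open>auto dest: dvd_imp_le\<close>)
  also have "\<dots> = exp (of_nat (s + 1) * (2 * of_real pi * of_int m * \<i> / of_nat n))"
    unfolding q exp_of_nat_mult ..
  also have "of_nat (s + 1) * (2 * of_real pi * of_int m * \<i> / of_nat n)
      = 2 * of_real pi * of_int m * \<i> / (3 :: complex)"
  proof -
    define c where "c = (of_nat (s + 1) :: complex)"
    have "c \<noteq> 0" unfolding c_def of_nat_eq_0_iff by simp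
    moreover have n3: "of_nat n = 3 * c" using s by (simp add: c_def)
    ultimately show ?thesis unfolding n3 c_def[symmetric] by simp
  qed
  finally show "(\<Sum>k=0..n-1. q ^ k * poly (qcatalan k) q)
      = 1 / 2 * (\<i> * of_real (sqrt 3) * of_int (Legendre m 3) - 1)"
    unfolding exp_int_third[OF \<open>\<not> 3 dvd m\<close>] .
next
  fix p a :: nat
  assume p: "prime p"
  have "{0..N - 1} = {..<N}" if "N > 0" for N :: nat using that by auto
  then have "{0..p ^ a - 1} = {..<p ^ a}" using prime_gt_0_nat[OF p] by simp
  then show "rat_cong p (\<Sum>k=0..p^a-1. catalan k)
      (1 / 2 * (3 * of_int (Legendre (int (p ^ a)) 3) - 1))"
    using catalan_sum_rat_cong[OF p] by simp
qed

end
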